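(* Let $\Psi(x)=\psi^{(m)}\mathbf\Theta_m(x)$ and $\Xi(x)=\xi^{(n)}\mathbf\Theta_n(x)$ be two arbitrary polynomials of degrees $m$ and $n$, given in a polynomial basis, where $\psi^{(m)}=[\psi_0\ \psi_1\ \cdots\ \psi_m]$ and $\xi^{(n)}=[\xi_0\ \xi_1\ \cdots\ \xi_n]$ are row vectors of coefficients. Then $$\Xi(x)\Psi(x)=\xi^{(n)}\,\mathcal H_{n,m}\,\mathbf\Theta_{n+m}(x),\qquad\text{where}\qquad \mathcal H_{n,m}=\sum_{k=0}^{m}\psi_k\,\tilde{\mathbf H}_{n,k}.$$
   Context: All polynomials are real polynomials in one variable $x$. A polynomial basis means that for every integer $N\ge 0$ we are given a family $\theta_{0,N}(x),\dots,\theta_{N,N}(x)$ which is a basis of the space of real polynomials of degree at most $N$; write $\mathbf\Theta_N(x)=[\theta_{0,N}(x),\dots,\theta_{N,N}(x)]^T$. For non-negative integers $n,m$ and $0\le k\le m$, the operational matrix $\tilde{\mathbf H}_{n,k}$ is the unique constant $(n+1)\times(n+m+1)$ matrix with $\theta_{k,m}(x)\mathbf\Theta_n(x)=\tilde{\mathbf H}_{n,k}\mathbf\Theta_{n+m}(x)$ (it may depend on $m$). *)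

theory Defs
  imports
    "HOL-Computational_Algebra.Polynomial"
    "Jordan_Normal_Form.Matrix"
begin

global_interpretation real_poly: Vector_Spaces.vector_space "Polynomial.smult :: real \<Rightarrow> real poly \<Rightarrow> real poly"
  by unfold_locales (simp_all add: smult_add_right smult_add_left)

text \<open>\<open>\<theta> N i\<close> stands for $\theta_{i,N}$; only the values with \<open>i \<le> N\<close> matter. Injectivity is
  required because independence and span speak about the set of members, not about the family.\<close>

definition polynomial_basis :: "(nat \<Rightarrow> nat \<Rightarrow> real poly) \<Rightarrow> bool" where
  "polynomial_basis \<theta> \<longleftrightarrow>
     (\<forall>N. inj_on (\<theta> N) {..N} \<and>
          \<not> real_poly.dependent (\<theta> N ` {..N}) \<and>
          real_poly.span (\<theta> N ` {..N}) = {p. degree p \<le> N})"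

definition Theta :: "(nat \<Rightarrow> nat \<Rightarrow> real poly) \<Rightarrow> nat \<Rightarrow> real \<Rightarrow> real vec" where
  "Theta \<theta> N x = vec (N + 1) (\<lambda>i. poly (\<theta> N i) x)"

text \<open>The matrix $\tilde{\mathbf H}_{n,k}$, with its dependence on \<open>m\<close> made explicit. The description
  is proper when \<open>polynomial_basis \<theta>\<close> holds and \<open>k \<le> m\<close>.\<close>

definition operational_mat :: "(nat \<Rightarrow> nat \<Rightarrow> real poly) \<Rightarrow> nat \<Rightarrow> nat \<Rightarrow> nat \<Rightarrow> real mat" where
  "operational_mat \<theta> m n k =
     (THE H. H \<in> carrier_mat (n + 1) (n + m + 1) \<and>
             (\<forall>x. poly (\<theta> m k) x \<cdot>\<^sub>v Theta \<theta> n x = H *\<^sub>v Theta \<theta> (n + m) x))"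

definition product_mat :: "(nat \<Rightarrow> nat \<Rightarrow> real poly) \<Rightarrow> nat \<Rightarrow> nat \<Rightarrow> real vec \<Rightarrow> real mat" where
  "product_mat \<theta> n m \<psi> =
     finsum (module_mat TYPE(real) (n + 1) (n + m + 1))
       (\<lambda>k. (\<psi> $ k) \<cdot>\<^sub>m operational_mat \<theta> m n k) {..m}"

end

theory Submission
  imports Defs
begin

text \<open>The operational matrix exists and is unique because the rows on both sides are polynomials
  of degree at most \<open>n + m\<close>, so they have unique coordinates in the basis of that space. Summing
  $\psi_k\theta_{k,m}(x)\mathbf\Theta_n(x) = \psi_k\tilde{\mathbf H}_{n,k}\mathbf\Theta_{n+m}(x)$
  over \<open>k\<close> gives $\Psi(x)\mathbf\Theta_n(x) = \mathcal H_{n,m}\mathbf\Theta_{n+m}(x)$, and it remains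
  to multiply by $\xi^{(n)}$.\<close>

lemma dim_Theta [simp]: "dim_vec (Theta \<theta> N x) = N + 1"
  by (simp add: Theta_def)

lemma index_Theta [simp]: "i \<le> N \<Longrightarrow> Theta \<theta> N x $ i = poly (\<theta> N i) x"
  by (simp add: Theta_def)

text \<open>The scalar product sums over the dimension of its right argument, here
  \<open>N + 1\<close>, which fixes the range \<open>j \<le> N\<close>.\<close>

lemma scalar_prod_Theta: "v \<bullet> Theta \<theta> N x = (\<Sum>j\<le>N. v $ j * poly (\<theta> N j) x)"
  unfolding scalar_prod_def by (rule sum.cong) auto

lemma mult_mat_Theta_index:
  assumes "H \<in> carrier_mat r (N + 1)" "i < r"
  shows "(H *\<^sub>v Theta \<theta> N x) $ i = (\<Sum>j\<le>N. H $$ (i, j) * poly (\<theta> N j) x)"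
  using assms by (simp add: scalar_prod_Theta)

lemma polynomial_basis_degree:
  assumes "polynomial_basis \<theta>" "k \<le> N"
  shows "degree (\<theta> N k) \<le> N"
proof -
  have "\<theta> N k \<in> real_poly.span (\<theta> N ` {..N})"
    using assms(2) by (intro real_poly.span_base) auto
  then show ?thesis
    using assms(1) by (simp add: polynomial_basis_def)
qed

text \<open>Membership in the span of a finite set gives a combination indexed by the members;
  injectivity of \<open>\<theta> N\<close> reindexes it by \<open>{..N}\<close>.\<close>

lemma polynomial_basis_expansion:
  assumes "polynomial_basis \<theta>" "degree p \<le> N"
  obtains c where "p = (\<Sum>j\<le>N. Polynomial.smult (c j) (\<theta> N j))"
proof -
  have inj: "inj_on (\<theta> N) {..N}" and "p \<in> real_poly.span (\<theta> N ` {..N})"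
    using assms by (auto simp: polynomial_basis_def)
  then obtain u where "p = (\<Sum>v\<in>\<theta> N ` {..N}. Polynomial.smult (u v) v)"
    by (auto simp: real_poly.span_finite)
  then have "p = (\<Sum>j\<le>N. Polynomial.smult ((u \<circ> \<theta> N) j) (\<theta> N j))"
    using inj by (simp add: sum.reindex)
  then show thesis by (rule that)
qed

lemma polynomial_basis_coeff_zero:
  assumes "polynomial_basis \<theta>" "(\<Sum>j\<le>N. Polynomial.smult (c j) (\<theta> N j)) = 0" "j \<le> N"
  shows "c j = 0"
proof -
  have inj: "inj_on (\<theta> N) {..N}" and ind: "\<not> real_poly.dependent (\<theta> N ` {..N})"
    using assms(1) by (auto simp: polynomial_basis_def)
  \<comment> \<open>Independence is about coefficients attached to polynomials, so \<open>c\<close>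
    is carried over to the members of the basis by inverting \<open>\<theta> N\<close> on
    \<open>{..N}\<close>.\<close>
  define u where "u = c \<circ> the_inv_into {..N} (\<theta> N)"
  have u: "u (\<theta> N i) = c i" if "i \<le> N" for i
    using the_inv_into_f_f[OF inj] that by (simp add: u_def)
  have "(\<Sum>v\<in>\<theta> N ` {..N}. Polynomial.smult (u v) v) = 0"
    using inj u assms(2) by (simp add: sum.reindex)
  then have "u (\<theta> N j) = 0"
    using assms(3) by (intro real_poly.independentD[OF ind, of "\<theta> N ` {..N}"]) auto
  then show ?thesis
    using u assms(3) by simp
qed

text \<open>The hypothesis is pointwise because operational matrices are characterised by values at
  every \<open>x\<close>. Real polynomials with equal values everywhere coincide, so the difference
  of the two combinations is the zero polynomial.\<close>

lemma polynomial_basis_coeff_unique: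
  assumes "polynomial_basis \<theta>"
    and "\<And>x. (\<Sum>j\<le>N. c j * poly (\<theta> N j) x) = (\<Sum>j\<le>N. d j * poly (\<theta> N j) x)"
    and "j \<le> N"
  shows "c j = d j"
proof -
  have "(\<Sum>j\<le>N. Polynomial.smult (c j - d j) (\<theta> N j)) = 0"
    by (rule poly_ext) (simp add: poly_sum left_diff_distrib sum_subtractf assms(2))
  from polynomial_basis_coeff_zero[OF assms(1) this assms(3)] show ?thesis by simp
qed

text \<open>This makes the description in \<open>operational_mat\<close> proper. Row
  \<open>i\<close> of the matrix must be the coordinate vector of
  \<open>\<theta> m k * \<theta> n i\<close> in the basis at level \<open>n + m\<close>.\<close>

lemma operational_mat_ex1:
  assumes B: "polynomial_basis \<theta>" and k: "k \<le> m"
  shows "\<exists>!H. H \<in> carrier_mat (n + 1) (n + m + 1) \<and>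
             (\<forall>x. poly (\<theta> m k) x \<cdot>\<^sub>v Theta \<theta> n x = H *\<^sub>v Theta \<theta> (n + m) x)"
proof (rule ex_ex1I)
  have "\<exists>c. \<theta> m k * \<theta> n i = (\<Sum>j\<le>n + m. Polynomial.smult (c j) (\<theta> (n + m) j))" if "i \<le> n" for i
  proof -
    have "degree (\<theta> m k * \<theta> n i) \<le> n + m"
      using degree_mult_le[of "\<theta> m k" "\<theta> n i"] polynomial_basis_degree[OF B k]
        polynomial_basis_degree[OF B that] by linarith
    from polynomial_basis_expansion[OF B this] show ?thesis by metis
  qed
  then obtain c where c: "\<And>i. i \<le> n \<Longrightarrow>
      \<theta> m k * \<theta> n i = (\<Sum>j\<le>n + m. Polynomial.smult (c i j) (\<theta> (n + m) j))"
    by metis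
  define H where "H = mat (n + 1) (n + m + 1) (\<lambda>(i, j). c i j)"
  have H: "H \<in> carrier_mat (n + 1) (n + m + 1)"
    by (simp add: H_def)
  have "poly (\<theta> m k) x \<cdot>\<^sub>v Theta \<theta> n x = H *\<^sub>v Theta \<theta> (n + m) x" for x
  proof (rule eq_vecI)
    fix i assume "i < dim_vec (H *\<^sub>v Theta \<theta> (n + m) x)"
    then have i: "i < n + 1" by (simp add: H_def)
    have "poly (\<theta> m k) x * poly (\<theta> n i) x = (\<Sum>j\<le>n + m. c i j * poly (\<theta> (n + m) j) x)"
      using arg_cong[OF c[of i], of "\<lambda>p. poly p x"] i by (simp add: poly_sum)
    then show "(poly (\<theta> m k) x \<cdot>\<^sub>v Theta \<theta> n x) $ i = (H *\<^sub>v Theta \<theta> (n + m) x) $ i"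
      using i by (subst mult_mat_Theta_index[OF H i]) (simp add: H_def)
  qed (simp add: H_def)
  with H show "\<exists>H. H \<in> carrier_mat (n + 1) (n + m + 1) \<and>
      (\<forall>x. poly (\<theta> m k) x \<cdot>\<^sub>v Theta \<theta> n x = H *\<^sub>v Theta \<theta> (n + m) x)" by blast
next
  fix G H
  assume "G \<in> carrier_mat (n + 1) (n + m + 1) \<and>
      (\<forall>x. poly (\<theta> m k) x \<cdot>\<^sub>v Theta \<theta> n x = G *\<^sub>v Theta \<theta> (n + m) x)"
    and "H \<in> carrier_mat (n + 1) (n + m + 1) \<and>
      (\<forall>x. poly (\<theta> m k) x \<cdot>\<^sub>v Theta \<theta> n x = H *\<^sub>v Theta \<theta> (n + m) x)"
  then have G: "G \<in> carrier_mat (n + 1) (n + m + 1)" and H: "H \<in> carrier_mat (n + 1) (n + m + 1)"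
    and eq: "\<And>x. G *\<^sub>v Theta \<theta> (n + m) x = H *\<^sub>v Theta \<theta> (n + m) x" by auto
  show "G = H"
  proof (rule eq_matI)
    fix i j assume "i < dim_row H" "j < dim_col H"
    then have i: "i < n + 1" and j: "j \<le> n + m" using H by auto
    \<comment> \<open>Row \<open>i\<close> of \<open>G\<close> and row \<open>i\<close> of
      \<open>H\<close> expand the same function of \<open>x\<close>, so their coordinates can be
      compared.\<close>
    have "(\<Sum>j\<le>n + m. G $$ (i, j) * poly (\<theta> (n + m) j) x) =
        (\<Sum>j\<le>n + m. H $$ (i, j) * poly (\<theta> (n + m) j) x)" for x
      using mult_mat_Theta_index[OF G i] mult_mat_Theta_index[OF H i] eq by metis
    from polynomial_basis_coeff_unique[OF B this j] show "G $$ (i, j) = H $$ (i, j)" .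
  qed (use G H in auto)
qed

text \<open>These two properties are all that the later argument uses about
  \<open>operational_mat\<close>.\<close>

lemma
  assumes "polynomial_basis \<theta>" "k \<le> m"
  shows operational_mat_carrier: "operational_mat \<theta> m n k \<in> carrier_mat (n + 1) (n + m + 1)"
    and operational_mat_mult_Theta:
      "operational_mat \<theta> m n k *\<^sub>v Theta \<theta> (n + m) x = poly (\<theta> m k) x \<cdot>\<^sub>v Theta \<theta> n x"
  using theI'[OF operational_mat_ex1[OF assms, of n], folded operational_mat_def] by simp_all

text \<open>Turns the sum in the module of matrices into ordinary sums of entries. The fixed size
  \<open>nr\<close>, \<open>nc\<close> gives the empty sum its meaning, the zero matrix of that
  size.\<close>

lemma finsum_mat:
  fixes A :: "'b \<Rightarrow> 'a :: comm_ring_1 mat"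
  assumes "finite S" "\<And>k. k \<in> S \<Longrightarrow> A k \<in> carrier_mat nr nc"
  shows "finsum (module_mat TYPE('a) nr nc) A S = mat nr nc (\<lambda>ij. \<Sum>k\<in>S. A k $$ ij)"
proof -
  interpret abelian_group "module_mat TYPE('a) nr nc"
    by (rule abelian_group_mat)
  from assms show ?thesis
  proof (induction S rule: finite_induct)
    case empty
    then show ?case by (auto simp: module_mat_simps intro!: eq_matI)
  next
    case (insert k S)
    \<comment> \<open>Splitting off a summand of \<open>finsum\<close> requires all summands to lie
      in the carrier of the module.\<close>
    then have "A \<in> S \<rightarrow> carrier (module_mat TYPE('a) nr nc)"
      and "A k \<in> carrier (module_mat TYPE('a) nr nc)"
      by (auto simp: module_mat_simps)
    then have "finsum (module_mat TYPE('a) nr nc) A (insert k S) =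
        A k + finsum (module_mat TYPE('a) nr nc) A S"
      using insert.hyps by (simp add: finsum_insert module_mat_simps)
    then show ?case
      using insert by (auto intro!: eq_matI)
  qed
qed

text \<open>The heart of the theorem, before multiplication by \<xi>: the product matrix represents
  multiplication of the basis vector by the polynomial with coefficients \<psi>.\<close>

lemma product_mat_mult_Theta:
  assumes B: "polynomial_basis \<theta>"
  shows "product_mat \<theta> n m \<psi> *\<^sub>v Theta \<theta> (n + m) x = (\<psi> \<bullet> Theta \<theta> m x) \<cdot>\<^sub>v Theta \<theta> n x"
proof -
  let ?H = "operational_mat \<theta> m n"
  have P: "product_mat \<theta> n m \<psi> =
      mat (n + 1) (n + m + 1) (\<lambda>ij. \<Sum>k\<le>m. (\<psi> $ k \<cdot>\<^sub>m ?H k) $$ ij)"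
    unfolding product_mat_def
    by (rule finsum_mat) (use operational_mat_carrier[OF B] in auto)
  then have carrier: "product_mat \<theta> n m \<psi> \<in> carrier_mat (n + 1) (n + m + 1)" by simp
  show ?thesis
  proof (rule eq_vecI)
    fix i assume "i < dim_vec ((\<psi> \<bullet> Theta \<theta> m x) \<cdot>\<^sub>v Theta \<theta> n x)"
    then have i: "i < n + 1" by simp
    have entry: "product_mat \<theta> n m \<psi> $$ (i, j) = (\<Sum>k\<le>m. \<psi> $ k * ?H k $$ (i, j))"
      if "j \<le> n + m" for j
    proof -
      have "(\<psi> $ k \<cdot>\<^sub>m ?H k) $$ (i, j) = \<psi> $ k * ?H k $$ (i, j)" if "k \<le> m" for k
        using operational_mat_carrier[OF B that, of n] i \<open>j \<le> n + m\<close> by (intro index_smult_mat) auto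
      then show ?thesis
        using i that by (simp add: P)
    qed
    \<comment> \<open>Component \<open>i\<close> of the defining equation of the \<open>k\<close>-th
      operational matrix.\<close>
    have row: "(\<Sum>j\<le>n + m. ?H k $$ (i, j) * poly (\<theta> (n + m) j) x) =
        poly (\<theta> m k) x * poly (\<theta> n i) x" if "k \<le> m" for k
      using mult_mat_Theta_index[OF operational_mat_carrier[OF B that] i, of \<theta> x]
        operational_mat_mult_Theta[OF B that, of n x] i by simp
    have "(product_mat \<theta> n m \<psi> *\<^sub>v Theta \<theta> (n + m) x) $ i =
        (\<Sum>j\<le>n + m. \<Sum>k\<le>m. \<psi> $ k * (?H k $$ (i, j) * poly (\<theta> (n + m) j) x))"
      by (subst mult_mat_Theta_index[OF carrier i])
        (simp add: entry sum_distrib_right mult.assoc)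
    \<comment> \<open>Exchanging the sums puts the sum over \<open>j\<close> inside, where
      \<open>row\<close> evaluates it for each \<open>k\<close>.\<close>
    also have "\<dots> = (\<Sum>k\<le>m. \<psi> $ k * (\<Sum>j\<le>n + m. ?H k $$ (i, j) * poly (\<theta> (n + m) j) x))"
      by (subst sum.swap) (simp add: sum_distrib_left)
    also have "\<dots> = (\<Sum>k\<le>m. \<psi> $ k * poly (\<theta> m k) x) * poly (\<theta> n i) x"
      by (simp add: row sum_distrib_right mult.assoc)
    also have "\<dots> = ((\<psi> \<bullet> Theta \<theta> m x) \<cdot>\<^sub>v Theta \<theta> n x) $ i"
      using i by (simp add: scalar_prod_Theta)
    finally show "(product_mat \<theta> n m \<psi> *\<^sub>v Theta \<theta> (n + m) x) $ i =
        ((\<psi> \<bullet> Theta \<theta> m x) \<cdot>\<^sub>v Theta \<theta> n x) $ i" .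
  qed (use carrier in simp)
qed

theorem theorem3p2:
  fixes \<theta> :: "nat \<Rightarrow> nat \<Rightarrow> real poly"
    and m n :: nat
    and \<psi> \<xi> :: "real vec"
    and \<Psi> \<Xi> :: "real poly"
  assumes "polynomial_basis \<theta>"
    and "\<psi> \<in> carrier_vec (m + 1)"
    and "\<xi> \<in> carrier_vec (n + 1)"
    and "\<And>x. poly \<Psi> x = \<psi> \<bullet> Theta \<theta> m x"
    and "\<And>x. poly \<Xi> x = \<xi> \<bullet> Theta \<theta> n x"
  shows "\<forall>x. poly \<Xi> x * poly \<Psi> x = \<xi> \<bullet> (product_mat \<theta> n m \<psi> *\<^sub>v Theta \<theta> (n + m) x)"
proof
  fix x
  \<comment> \<open>The scalar \<open>\<psi> \<bullet> Theta \<theta> m x\<close> is the value of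
    \<Psi> at \<open>x\<close> and comes out of the scalar product with \<xi>.\<close>
  have "\<xi> \<bullet> (product_mat \<theta> n m \<psi> *\<^sub>v Theta \<theta> (n + m) x) = poly \<Psi> x * (\<xi> \<bullet> Theta \<theta> n x)"
    using assms(3) by (simp add: product_mat_mult_Theta[OF assms(1)] assms(4))
  then show "poly \<Xi> x * poly \<Psi> x = \<xi> \<bullet> (product_mat \<theta> n m \<psi> *\<^sub>v Theta \<theta> (n + m) x)"
    by (simp add: assms(5))
qed

end
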